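(* Let $\Omega$ be a finite set, let $H \le G := \mathrm{Sym}(\Omega)$ and let $\alpha,\beta\in\Omega$ be distinct. Let $\Gamma := \Gamma(H,\Omega,(\alpha,\beta))$ be the orbital graph of $H$ with base-pair $(\alpha,\beta)$. Then $\Gamma$ is futile if and only if one of the following conditions is true: (i) $\beta\in\alpha^H$ and $|\beta^{H_\alpha}|+1=|\alpha^H|$; (ii) $\beta\notin\alpha^H$ and $|\beta^{H_\alpha}|=|\beta^H|$.
   Context: Permutations act on the right: $\omega^h$ is the image of $\omega\in\Omega$ under $h$, $\omega^K$ is the orbit of $\omega$ under a subgroup $K\le \mathrm{Sym}(\Omega)$, and $H_\alpha$ is the stabilizer of the point $\alpha$ in $H$. The orbital graph $\Gamma(H,\Omega,(\alpha,\beta))$ (for $\alpha\neq\beta$) is the digraph with vertex set $\Omega$ and arc set $\{(\alpha^h,\beta^h)\mid h\in H\}$. Let $P$ be an ordered orbit partition of $H$ (the partition of $\Omega$ into $H$-orbits, listed in some order). Let $G_P$ be the stabilizer of $P$ in $G=\mathrm{Sym}(\Omega)$, i.e. the group of all permutations of $\Omega$ that stabilize every $H$-orbit as a set (so $G_P$ acts as the full symmetric group on every orbit). The orbital graph $\Gamma$ is called futile if and only if $G_P$, in its natural action on $\Omega$, induces graph automorphisms on $\Gamma$ (i.e. every element of $G_P$ is a digraph automorphism of $\Gamma$). *)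

theory Defs
  imports
    "HOL-Algebra.Group_Action"
    "Graph_Theory.Digraph_Isomorphism"
    "Graph_Theory.Pair_Digraph"
begin

text \<open>
  The symmetric group on \<Omega> is \<^term>\<open>BijGroup \<Omega>\<close>; its elements are functions that are extensional
  on \<Omega>, and its multiplication is composition from right to left. The image of a point under a
  permutation is function application \<open>h \<omega>\<close>. Subgroups, orbits and stabilizers do not depend on
  whether permutations are composed from the left or from the right.
\<close>

abbreviation perm_group :: "'a set \<Rightarrow> ('a \<Rightarrow> 'a) set \<Rightarrow> ('a \<Rightarrow> 'a) monoid" where
  "perm_group \<Omega> H \<equiv> (BijGroup \<Omega>)\<lparr>carrier := H\<rparr>"

definition point_orbit :: "'a set \<Rightarrow> ('a \<Rightarrow> 'a) set \<Rightarrow> 'a \<Rightarrow> 'a set" where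
  "point_orbit \<Omega> H \<omega> = orbit (perm_group \<Omega> H) (\<lambda>h. h) \<omega>"

definition point_stabilizer :: "'a set \<Rightarrow> ('a \<Rightarrow> 'a) set \<Rightarrow> 'a \<Rightarrow> ('a \<Rightarrow> 'a) set" where
  "point_stabilizer \<Omega> H \<omega> = stabilizer (perm_group \<Omega> H) (\<lambda>h. h) \<omega>"

definition orbital_graph :: "('a \<Rightarrow> 'a) set \<Rightarrow> 'a set \<Rightarrow> 'a \<times> 'a \<Rightarrow> 'a pair_pre_digraph" where
  "orbital_graph H \<Omega> bp =
     \<lparr>pverts = \<Omega>, parcs = {(h (fst bp), h (snd bp)) | h. h \<in> H}\<rparr>"

definition ordered_orbit_partition :: "('a \<Rightarrow> 'a) set \<Rightarrow> 'a set \<Rightarrow> 'a set list \<Rightarrow> bool" where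
  "ordered_orbit_partition H \<Omega> P \<longleftrightarrow>
     distinct P \<and> set P = orbits (perm_group \<Omega> H) \<Omega> (\<lambda>h. h)"

text \<open>The stabilizer in the symmetric group of a list of subsets of \<Omega>, under the cellwise action.\<close>

definition partition_stabilizer :: "'a set \<Rightarrow> 'a set list \<Rightarrow> ('a \<Rightarrow> 'a) set" where
  "partition_stabilizer \<Omega> P = stabilizer (BijGroup \<Omega>) (\<lambda>g. map (\<lambda>\<Delta>. g ` \<Delta>)) P"

lemma partition_stabilizer_iff:
  "g \<in> partition_stabilizer \<Omega> P \<longleftrightarrow> g \<in> Bij \<Omega> \<and> (\<forall>\<Delta>\<in>set P. g ` \<Delta> = \<Delta>)"
proof -
  have "map (\<lambda>\<Delta>. g ` \<Delta>) P = P \<longleftrightarrow> (\<forall>\<Delta>\<in>set P. g ` \<Delta> = \<Delta>)"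
    by (induction P) auto
  then show ?thesis
    by (simp add: partition_stabilizer_def stabilizer_def BijGroup_def)
qed

text \<open>
  An automorphism is a digraph isomorphism whose image is the digraph itself; since arcs are pairs
  of vertices, the map on arcs is determined by the map on vertices.
\<close>

definition induced_iso :: "('a \<Rightarrow> 'a) \<Rightarrow> ('a, 'a \<times> 'a, 'a, 'a \<times> 'a) digraph_isomorphism" where
  "induced_iso f = \<lparr>iso_verts = f, iso_arcs = map_prod f f, iso_head = snd, iso_tail = fst\<rparr>"

definition digraph_automorphism :: "'a pair_pre_digraph \<Rightarrow> ('a \<Rightarrow> 'a) \<Rightarrow> bool" where
  "digraph_automorphism \<Gamma> f \<longleftrightarrow>
     pre_digraph.digraph_isomorphism (with_proj \<Gamma>) (induced_iso f) \<and>
     app_iso (induced_iso f) (with_proj \<Gamma>) = with_proj \<Gamma>"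

lemma digraph_automorphism_iff:
  assumes "wf_digraph (with_proj \<Gamma>)"
  shows "digraph_automorphism \<Gamma> f \<longleftrightarrow>
    bij_betw f (pverts \<Gamma>) (pverts \<Gamma>) \<and>
    (\<forall>u\<in>pverts \<Gamma>. \<forall>v\<in>pverts \<Gamma>. (u, v) \<in> parcs \<Gamma> \<longleftrightarrow> (f u, f v) \<in> parcs \<Gamma>)"
    (is "?L \<longleftrightarrow> ?R")
proof -
  have sub: "u \<in> pverts \<Gamma> \<and> v \<in> pverts \<Gamma>" if "(u, v) \<in> parcs \<Gamma>" for u v
    using that wf_digraph.tail_in_verts[OF assms, of "(u, v)"]
      wf_digraph.head_in_verts[OF assms, of "(u, v)"] by simp
  have L: "?L \<longleftrightarrow> inj_on f (pverts \<Gamma>) \<and> inj_on (map_prod f f) (parcs \<Gamma>) \<and>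
      f ` pverts \<Gamma> = pverts \<Gamma> \<and> map_prod f f ` parcs \<Gamma> = parcs \<Gamma>"
    using assms
    by (simp add: digraph_automorphism_def pre_digraph.digraph_isomorphism_def
        induced_iso_def app_iso_def with_proj_def)
  have inj: "inj_on (map_prod f f) (parcs \<Gamma>)" if "inj_on f (pverts \<Gamma>)"
    using map_prod_inj_on[OF that that] by (rule inj_on_subset) (use sub in auto)
  have arcs: "map_prod f f ` parcs \<Gamma> = parcs \<Gamma> \<longleftrightarrow>
      (\<forall>u\<in>pverts \<Gamma>. \<forall>v\<in>pverts \<Gamma>. (u, v) \<in> parcs \<Gamma> \<longleftrightarrow> (f u, f v) \<in> parcs \<Gamma>)"
    if f: "inj_on f (pverts \<Gamma>)" "f ` pverts \<Gamma> = pverts \<Gamma>"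
  proof
    assume eq: "map_prod f f ` parcs \<Gamma> = parcs \<Gamma>"
    show "\<forall>u\<in>pverts \<Gamma>. \<forall>v\<in>pverts \<Gamma>. (u, v) \<in> parcs \<Gamma> \<longleftrightarrow> (f u, f v) \<in> parcs \<Gamma>"
    proof (intro ballI iffI)
      fix u v assume "(u, v) \<in> parcs \<Gamma>"
      then have "(f u, f v) \<in> map_prod f f ` parcs \<Gamma>" by (rule map_prod_imageI)
      then show "(f u, f v) \<in> parcs \<Gamma>" unfolding eq .
    next
      fix u v assume uv: "u \<in> pverts \<Gamma>" "v \<in> pverts \<Gamma>" "(f u, f v) \<in> parcs \<Gamma>"
      then have "(f u, f v) \<in> map_prod f f ` parcs \<Gamma>" unfolding eq by blast
      then obtain u' v' where *: "(u', v') \<in> parcs \<Gamma>" "f u = f u'" "f v = f v'" by blast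
      then have "u = u'" "v = v'" using uv sub[OF *(1)] inj_onD[OF f(1)] by blast+
      then show "(u, v) \<in> parcs \<Gamma>" using * by blast
    qed
  next
    assume R: "\<forall>u\<in>pverts \<Gamma>. \<forall>v\<in>pverts \<Gamma>. (u, v) \<in> parcs \<Gamma> \<longleftrightarrow> (f u, f v) \<in> parcs \<Gamma>"
    show "map_prod f f ` parcs \<Gamma> = parcs \<Gamma>"
    proof (intro equalityI subsetI)
      fix e assume "e \<in> map_prod f f ` parcs \<Gamma>"
      then obtain u v where "(u, v) \<in> parcs \<Gamma>" "e = (f u, f v)" by blast
      then show "e \<in> parcs \<Gamma>" using R sub by blast
    next
      fix e assume e: "e \<in> parcs \<Gamma>"
      obtain a b where ab: "e = (a, b)" by (cases e)
      then have "a \<in> f ` pverts \<Gamma>" "b \<in> f ` pverts \<Gamma>"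
        using e sub unfolding f(2) by blast+
      then obtain u v where
        uv: "u \<in> pverts \<Gamma>" "v \<in> pverts \<Gamma>" "a = f u" "b = f v" by blast
      then have "(u, v) \<in> parcs \<Gamma>" using e ab R by blast
      then show "e \<in> map_prod f f ` parcs \<Gamma>" using map_prod_imageI ab uv by blast
    qed
  qed
  show ?thesis
    unfolding L bij_betw_def using inj arcs by blast
qed

definition futile :: "'a set list \<Rightarrow> 'a pair_pre_digraph \<Rightarrow> bool" where
  "futile P \<Gamma> \<longleftrightarrow> (\<forall>g \<in> partition_stabilizer (pverts \<Gamma>) P. digraph_automorphism \<Gamma> g)"

end

theory Submission
  imports Defs "HOL-Combinatorics.Transposition"
begin

text \<open>
  The out-neighbours of \<open>\<alpha>\<close> in the orbital graph form the suborbit, that is, the orbit of \<open>\<beta>\<close>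
  under the stabilizer of \<open>\<alpha>\<close> (\<open>suborbit_iff_arc\<close>); it is contained in \<open>\<beta>\<^sup>H - {\<alpha>}\<close>. As \<open>\<Omega>\<close> is
  finite, each of the two counting conditions says that this inclusion is an equality: \<open>\<beta>\<^sup>H\<close> has one
  point more than \<open>\<beta>\<^sup>H - {\<alpha>}\<close> if it contains \<open>\<alpha>\<close>, that is, if \<open>\<beta> \<in> \<alpha>\<^sup>H\<close>, and the two sets
  coincide otherwise. So the theorem reduces to the claim that the graph is futile iff \<open>\<alpha>\<close> is joined
  to every other point of \<open>\<beta>\<^sup>H\<close>.

  If \<open>\<alpha>\<close> is joined to all these points, then by transitivity of \<open>H\<close> on \<open>\<alpha>\<^sup>H\<close> the arcs are exactly
  the pairs of distinct points in \<open>\<alpha>\<^sup>H \<times> \<beta>\<^sup>H\<close>, and this set is visibly preserved by every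
  permutation that preserves the orbits (\<open>arcs_if_suborbit_full\<close>, \<open>futile_if_suborbit_full\<close>).
  Conversely, for \<open>v \<in> \<beta>\<^sup>H - {\<alpha>}\<close> the transposition of \<open>\<beta>\<close> and \<open>v\<close> preserves all orbits and fixes
  \<open>\<alpha>\<close>; if it is an automorphism, it carries the arc \<open>(\<alpha>, \<beta>)\<close> to the arc \<open>(\<alpha>, v)\<close>
  (\<open>suborbit_full_if_futile\<close>).
\<close>

section \<open>Permutation groups and their orbits\<close>

lemma perm_group_action:
  assumes "subgroup H (BijGroup \<Omega>)"
  shows "group_action (perm_group \<Omega> H) \<Omega> (\<lambda>h. h)"
proof -
  interpret B: group "BijGroup \<Omega>" by (rule group_BijGroup)
  show ?thesis
    unfolding group_action_def using B.canonical_inj_is_hom[OF assms] by (simp add: id_def)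
qed

lemma point_orbit_eq: "point_orbit \<Omega> K \<omega> = {h \<omega> | h. h \<in> K}"
  by (simp add: point_orbit_def orbit_def)

lemma point_stabilizer_eq: "point_stabilizer \<Omega> H \<omega> = {h \<in> H. h \<omega> = \<omega>}"
  by (simp add: point_stabilizer_def stabilizer_def)

text \<open>
  An element of \<open>H\<close> that carries the arc \<open>(\<alpha>, \<beta>)\<close> to an arc leaving \<open>\<alpha>\<close> is exactly an element of
  the stabilizer of \<open>\<alpha>\<close>.
\<close>
lemma suborbit_iff_arc:
  "v \<in> point_orbit \<Omega> (point_stabilizer \<Omega> H \<alpha>) \<beta> \<longleftrightarrow> (\<alpha>, v) \<in> parcs (orbital_graph H \<Omega> (\<alpha>, \<beta>))"
proof -
  have "(\<exists>h\<in>H. h \<alpha> = \<alpha> \<and> v = h \<beta>) \<longleftrightarrow> (\<exists>h\<in>H. \<alpha> = h \<alpha> \<and> v = h \<beta>)" by metis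
  then show ?thesis
    by (simp add: point_orbit_eq point_stabilizer_eq orbital_graph_def Bex_def conj_ac)
qed

lemma pverts_orbital_graph [simp]: "pverts (orbital_graph H \<Omega> bp) = \<Omega>"
  by (simp add: orbital_graph_def)

context
  fixes \<Omega> :: "'a set" and H :: "('a \<Rightarrow> 'a) set"
  assumes H: "subgroup H (BijGroup \<Omega>)"
begin

interpretation group_action "perm_group \<Omega> H" \<Omega> "\<lambda>h. h"
  by (rule perm_group_action[OF H])

interpretation perm: group "perm_group \<Omega> H"
  by (rule subgroup.subgroup_is_group[OF H group_BijGroup])

lemma perm_image_mem: "h \<in> H \<Longrightarrow> x \<in> \<Omega> \<Longrightarrow> h x \<in> \<Omega>"
  using element_image by simp

lemma perm_eq_iff: "h \<in> H \<Longrightarrow> x \<in> \<Omega> \<Longrightarrow> y \<in> \<Omega> \<Longrightarrow> h x = h y \<longleftrightarrow> x = y"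
  using inj_prop[of h] by (auto dest: inj_onD)

lemma perm_comp:
  assumes "h \<in> H" "k \<in> H"
  obtains m where "m \<in> H" "\<And>x. x \<in> \<Omega> \<Longrightarrow> m x = h (k x)"
  using perm.m_closed[of h k] composition_rule[of _ h k] assms by auto

lemma mem_orbit_self: "x \<in> \<Omega> \<Longrightarrow> x \<in> point_orbit \<Omega> H x"
  unfolding point_orbit_def by (rule orbit_refl)

lemma point_orbit_subset: "x \<in> \<Omega> \<Longrightarrow> point_orbit \<Omega> H x \<subseteq> \<Omega>"
  by (auto simp: point_orbit_eq perm_image_mem)

lemma mem_orbit_iff:
  assumes "x \<in> \<Omega>" "y \<in> \<Omega>"
  shows "y \<in> point_orbit \<Omega> H x \<longleftrightarrow> point_orbit \<Omega> H y = point_orbit \<Omega> H x"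
  using disjoint_union[of "point_orbit \<Omega> H y" "point_orbit \<Omega> H x"] mem_orbit_self[OF assms(2)] assms
  by (auto simp: orbits_def point_orbit_def)

lemma perm_mem_orbit_iff:
  assumes "h \<in> H" "x \<in> \<Omega>" "y \<in> \<Omega>"
  shows "h y \<in> point_orbit \<Omega> H x \<longleftrightarrow> y \<in> point_orbit \<Omega> H x"
proof -
  have "h y \<in> point_orbit \<Omega> H y" using assms(1) by (auto simp: point_orbit_eq)
  then show ?thesis
    using mem_orbit_iff assms perm_image_mem[OF assms(1,3)] by simp
qed

lemma partition_stabilizer_orbits_iff:
  assumes "ordered_orbit_partition H \<Omega> P"
  shows "g \<in> partition_stabilizer \<Omega> P \<longleftrightarrow>
    g \<in> Bij \<Omega> \<and> (\<forall>x\<in>\<Omega>. g ` point_orbit \<Omega> H x = point_orbit \<Omega> H x)"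
proof -
  have "set P = point_orbit \<Omega> H ` \<Omega>"
    using assms by (auto simp: ordered_orbit_partition_def orbits_def point_orbit_def)
  then show ?thesis by (simp add: partition_stabilizer_iff)
qed

text \<open>
  Orbits are disjoint, so an orbit contains both of the exchanged points or neither of them.
\<close>
lemma transposition_in_partition_stabilizer:
  assumes P: "ordered_orbit_partition H \<Omega> P" and u: "u \<in> \<Omega>" and v: "v \<in> point_orbit \<Omega> H u"
  shows "restrict (transpose u v) \<Omega> \<in> partition_stabilizer \<Omega> P"
proof -
  have v': "v \<in> \<Omega>" using point_orbit_subset[OF u] v by blast
  have "transpose u v ` \<Omega> = \<Omega>"
    using u v' by (simp add: transpose_image_eq)
  then have "restrict (transpose u v) \<Omega> \<in> Bij \<Omega>"
    by (simp add: Bij_def bij_betw_def)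
  moreover have "restrict (transpose u v) \<Omega> ` point_orbit \<Omega> H x = point_orbit \<Omega> H x"
    if x: "x \<in> \<Omega>" for x
  proof -
    have "u \<in> point_orbit \<Omega> H x \<longleftrightarrow> v \<in> point_orbit \<Omega> H x"
      using mem_orbit_iff u v v' x by simp
    then have "transpose u v ` point_orbit \<Omega> H x = point_orbit \<Omega> H x"
      by (simp add: transpose_image_eq)
    moreover have "restrict (transpose u v) \<Omega> ` point_orbit \<Omega> H x =
        transpose u v ` point_orbit \<Omega> H x"
      using point_orbit_subset[OF x] by (intro image_cong) auto
    ultimately show ?thesis by simp
  qed
  ultimately show ?thesis
    using partition_stabilizer_orbits_iff[OF P] by blast
qed

section \<open>Futility in terms of the suborbit\<close>

context
  fixes \<alpha> \<beta> :: 'a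
  assumes base: "\<alpha> \<in> \<Omega>" "\<beta> \<in> \<Omega>" "\<alpha> \<noteq> \<beta>"
begin

private abbreviation (input) \<Gamma> where "\<Gamma> \<equiv> orbital_graph H \<Omega> (\<alpha>, \<beta>)"
private abbreviation (input) suborbit where "suborbit \<equiv> point_orbit \<Omega> (point_stabilizer \<Omega> H \<alpha>) \<beta>"

lemma arcs_subset:
  "parcs \<Gamma> \<subseteq> {(a, b). a \<in> point_orbit \<Omega> H \<alpha> \<and> b \<in> point_orbit \<Omega> H \<beta> \<and> a \<noteq> b}"
  using base perm_eq_iff by (auto simp: orbital_graph_def point_orbit_eq)

lemma suborbit_subset: "suborbit \<subseteq> point_orbit \<Omega> H \<beta> - {\<alpha>}"
  using arcs_subset by (auto simp: suborbit_iff_arc)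

lemma automorphism_iff:
  "digraph_automorphism \<Gamma> f \<longleftrightarrow> bij_betw f \<Omega> \<Omega> \<and>
    (\<forall>u\<in>\<Omega>. \<forall>v\<in>\<Omega>. (u, v) \<in> parcs \<Gamma> \<longleftrightarrow> (f u, f v) \<in> parcs \<Gamma>)"
proof -
  have "wf_digraph (with_proj \<Gamma>)"
    using arcs_subset base point_orbit_subset by unfold_locales (auto simp: subset_iff)
  from digraph_automorphism_iff[OF this] show ?thesis by simp
qed

text \<open>
  An element of \<open>H\<close> that carries \<open>\<alpha>\<close> to \<open>a\<close> also carries the out-neighbours of \<open>\<alpha>\<close> to those of
  \<open>a\<close>, so a full out-neighbourhood at \<open>\<alpha>\<close> is one at every point of its orbit.
\<close>
lemma arcs_if_suborbit_full:
  assumes full: "suborbit = point_orbit \<Omega> H \<beta> - {\<alpha>}"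
  shows "parcs \<Gamma> = {(a, b). a \<in> point_orbit \<Omega> H \<alpha> \<and> b \<in> point_orbit \<Omega> H \<beta> \<and> a \<noteq> b}"
proof (intro equalityI arcs_subset subsetI)
  fix e assume "e \<in> {(a, b). a \<in> point_orbit \<Omega> H \<alpha> \<and> b \<in> point_orbit \<Omega> H \<beta> \<and> a \<noteq> b}"
  then obtain a b where e: "e = (a, b)" and a: "a \<in> point_orbit \<Omega> H \<alpha>"
    and b: "b \<in> point_orbit \<Omega> H \<beta>" and "a \<noteq> b" by blast
  obtain k where k: "k \<in> H" "a = k \<alpha>" using a by (auto simp: point_orbit_eq)
  \<comment> \<open>Move \<open>(a, b)\<close> back by \<open>k\<close> to \<open>(\<alpha>, c)\<close>, where fullness supplies an arc.\<close>
  have "b \<in> \<Omega>" using b point_orbit_subset base by blast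
  then obtain c where c: "c \<in> \<Omega>" "b = k c"
    using surj_prop[of k] k(1) by auto
  have "c \<in> suborbit"
    using full b c \<open>a \<noteq> b\<close> k perm_mem_orbit_iff[OF k(1) base(2) c(1)] by auto
  then obtain s where s: "s \<in> H" "s \<alpha> = \<alpha>" "c = s \<beta>"
    by (auto simp: point_orbit_eq point_stabilizer_eq)
  obtain m where "m \<in> H" "\<And>x. x \<in> \<Omega> \<Longrightarrow> m x = k (s x)" using perm_comp k(1) s(1) by blast
  then have "m \<in> H \<and> e = (m \<alpha>, m \<beta>)"
    using base s c k e by simp
  then show "e \<in> parcs \<Gamma>" by (auto simp: orbital_graph_def)
qed

lemma futile_if_suborbit_full:
  assumes P: "ordered_orbit_partition H \<Omega> P"
    and full: "suborbit = point_orbit \<Omega> H \<beta> - {\<alpha>}"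
  shows "futile P \<Gamma>"
  unfolding futile_def
proof
  fix g assume "g \<in> partition_stabilizer (pverts \<Gamma>) P"
  then have g: "bij_betw g \<Omega> \<Omega>" "\<And>x. x \<in> \<Omega> \<Longrightarrow> g ` point_orbit \<Omega> H x = point_orbit \<Omega> H x"
    by (auto simp: partition_stabilizer_orbits_iff[OF P] Bij_def)
  have inj: "inj_on g \<Omega>" using g(1) by (rule bij_betw_imp_inj_on)
  have orb: "g u \<in> point_orbit \<Omega> H x \<longleftrightarrow> u \<in> point_orbit \<Omega> H x" if "x \<in> \<Omega>" "u \<in> \<Omega>" for x u
    using inj_on_image_mem_iff[OF inj that(2) point_orbit_subset[OF that(1)]] g(2)[OF that(1)]
    by simp
  have "(u, v) \<in> parcs \<Gamma> \<longleftrightarrow> (g u, g v) \<in> parcs \<Gamma>" if "u \<in> \<Omega>" "v \<in> \<Omega>" for u v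
    using that base orb inj_on_eq_iff[OF inj] by (simp add: arcs_if_suborbit_full[OF full])
  then show "digraph_automorphism \<Gamma> g"
    using g(1) by (simp add: automorphism_iff)
qed

lemma suborbit_full_if_futile:
  assumes P: "ordered_orbit_partition H \<Omega> P" and "futile P \<Gamma>"
  shows "suborbit = point_orbit \<Omega> H \<beta> - {\<alpha>}"
proof (intro equalityI suborbit_subset subsetI)
  fix v assume v: "v \<in> point_orbit \<Omega> H \<beta> - {\<alpha>}"
  let ?t = "restrict (transpose \<beta> v) \<Omega>"
  have "?t \<in> partition_stabilizer \<Omega> P"
    using transposition_in_partition_stabilizer[OF P] base v by blast
  then have "digraph_automorphism \<Gamma> ?t"
    using \<open>futile P \<Gamma>\<close> by (simp add: futile_def)
  moreover have "(\<alpha>, \<beta>) \<in> parcs \<Gamma>"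
  proof -
    have "(\<lambda>x\<in>\<Omega>. x) \<in> H"
      using perm.one_closed by (simp add: BijGroup_def)
    then show ?thesis
      using base by (auto simp: orbital_graph_def intro!: exI[of _ "\<lambda>x\<in>\<Omega>. x"])
  qed
  ultimately have "(?t \<alpha>, ?t \<beta>) \<in> parcs \<Gamma>"
    using base unfolding automorphism_iff by blast
  moreover have "?t \<alpha> = \<alpha>" "?t \<beta> = v"
    using base v by auto
  ultimately show "v \<in> suborbit"
    by (simp add: suborbit_iff_arc)
qed

lemma futile_iff_suborbit_full:
  "ordered_orbit_partition H \<Omega> P \<Longrightarrow> futile P \<Gamma> \<longleftrightarrow> suborbit = point_orbit \<Omega> H \<beta> - {\<alpha>}"
  using futile_if_suborbit_full suborbit_full_if_futile by blast

end

end

section \<open>The counting criterion\<close>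

theorem corollary3p6:
  fixes \<Omega> :: "'a set" and H :: "('a \<Rightarrow> 'a) set" and \<alpha> \<beta> :: 'a and P :: "'a set list"
  assumes "finite \<Omega>"
    and "subgroup H (BijGroup \<Omega>)"
    and "\<alpha> \<in> \<Omega>" and "\<beta> \<in> \<Omega>" and "\<alpha> \<noteq> \<beta>"
    and "ordered_orbit_partition H \<Omega> P"
  shows "futile P (orbital_graph H \<Omega> (\<alpha>, \<beta>)) \<longleftrightarrow>
    (\<beta> \<in> point_orbit \<Omega> H \<alpha> \<and>
       card (point_orbit \<Omega> (point_stabilizer \<Omega> H \<alpha>) \<beta>) + 1 = card (point_orbit \<Omega> H \<alpha>)) \<or>
    (\<beta> \<notin> point_orbit \<Omega> H \<alpha> \<and>
       card (point_orbit \<Omega> (point_stabilizer \<Omega> H \<alpha>) \<beta>) = card (point_orbit \<Omega> H \<beta>))"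
proof -
  let ?A = "point_orbit \<Omega> H \<alpha>" and ?B = "point_orbit \<Omega> H \<beta>"
    and ?S = "point_orbit \<Omega> (point_stabilizer \<Omega> H \<alpha>) \<beta>"
  note H = assms(2) and \<alpha> = assms(3) and \<beta> = assms(4)
  have fin: "finite ?B"
    using point_orbit_subset[OF H \<beta>] assms(1) by (rule finite_subset)
  have futile: "futile P (orbital_graph H \<Omega> (\<alpha>, \<beta>)) \<longleftrightarrow> ?S = ?B - {\<alpha>}"
    by (rule futile_iff_suborbit_full[OF H \<alpha> \<beta> assms(5,6)])
  have count: "?S = ?B - {\<alpha>} \<longleftrightarrow> card ?S = card (?B - {\<alpha>})"
    using card_subset_eq[OF finite_Diff[OF fin] suborbit_subset[OF H \<alpha> \<beta> assms(5)]] by metis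
  show ?thesis
  proof (cases "\<beta> \<in> ?A")
    case True
    then have B: "?B = ?A" and "\<alpha> \<in> ?B"
      using mem_orbit_iff[OF H \<alpha> \<beta>] mem_orbit_self[OF H \<alpha>] by auto
    then have "card ?A = card (?B - {\<alpha>}) + 1"
      using card.remove[OF fin] by simp
    then show ?thesis using True futile count by simp
  next
    case False
    then have "\<alpha> \<notin> ?B"
      using mem_orbit_iff[OF H \<alpha> \<beta>] mem_orbit_iff[OF H \<beta> \<alpha>] by auto
    then have "?B - {\<alpha>} = ?B" by simp
    then show ?thesis using False futile count by simp
  qed
qed

end
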